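(* There exist infinitely many primes $p$ for which there exists $a\in(\mathbb{Z}/5p\mathbb{Z})^*$ such that $a\bmod p$ generates $(\mathbb{Z}/p\mathbb{Z})^*$, $a^{(p-1)/2}\equiv-1\pmod{5p}$, and $S=S_{5p}(a)$ satisfies $|S\cap(S+1)|\equiv-2\pmod 5$.
   Context: $S_{pq}(a)=\{a^j:0\le j<p-1\}\subseteq\mathbb{Z}/pq\mathbb{Z}$ and $S+1=\{s+1:s\in S\}$. *)

theory Defs
  imports "HOL-Number_Theory.Number_Theory"
begin

text \<open>Residues mod n are represented by naturals in {0..<n}.
  S_n(a) = {a^j mod n : 0 <= j < p - 1} as a subset of Z/nZ.\<close>
definition S_set :: "nat \<Rightarrow> nat \<Rightarrow> nat \<Rightarrow> nat set" where
  "S_set n p a = (\<lambda>j. a ^ j mod n) ` {0..<p - 1}"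

definition shift1 :: "nat \<Rightarrow> nat set \<Rightarrow> nat set" where
  "shift1 n S = (\<lambda>s. (s + 1) mod n) ` S"

end

theory Submission
  imports "HOL-Algebra.Algebraic_Closure_Type" "Berlekamp_Zassenhaus.Finite_Field" Defs
begin

text \<open>
  If \<open>p mod 8 = 5\<close>, a primitive root \<open>a\<close> modulo \<open>p\<close> with \<open>a\<close> of order 4 modulo 5 defines a quartic
  character \<open>chi\<close> modulo \<open>p\<close> with values in a field of characteristic 5 by \<open>chi (a ^ j) = a ^ j\<close>, and
  the cardinality in question is the number of \<open>x\<close> with \<open>chi (x + 1) = chi x + 1\<close>. Detecting this
  equation by fourth powers expresses the count, as an element of the field, through Jacobi sums;
  for \<open>p mod 5 = 1\<close> it equals \<open>1 - J\<close> with \<open>J\<close> the sum of \<open>chi x * chi (x + 1) ^ 2\<close>.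

  The Gauss sum \<open>G\<close> of \<open>chi\<close> in characteristic 5 satisfies \<open>G ^ 4 = p * J ^ 2\<close>, while the Frobenius map
  gives \<open>G ^ 5 = chi 5 ^ 3 * G\<close>. So \<open>J ^ 2 = chi 5 ^ 3\<close>, which is \<open>-1\<close> as soon as -5 is a fourth
  power modulo \<open>p\<close>. Then \<open>J\<close> is 2 or 3; passing from \<open>chi\<close> to its inverse inverts \<open>J\<close>, so one of the two
  choices of \<open>a\<close> modulo 5 gives \<open>J = 3\<close> and the count \<open>1 - J = -2\<close>.

  Infinitely many primes \<open>p\<close> with \<open>p mod 8 = 5\<close>, \<open>p mod 5 = 1\<close> and -5 a fourth power are found in the
  manner of Euclid. With \<open>\<zeta>\<close> a primitive fifth root of unity and \<open>\<eta> = 1 + \<zeta> + \<zeta>\<^sup>2\<close>, a unit, the norm of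
  \<open>1 + 5 * n ^ 4 * \<eta> ^ 4\<close> is prime to \<open>5 * n\<close>, its prime divisors are 1 modulo 20 and make -5 a fourth
  power, and for odd \<open>n\<close> it is 5 modulo 8, so some prime divisor is not 1 modulo 8.
\<close>

section \<open>Character sums over a prime field\<close>

lemma of_nat_eq_iff_mod_5:
  assumes "CHAR('f::field) = 5"
  shows "of_nat m = (of_nat n :: 'f) \<longleftrightarrow> [m = n] (mod 5)"
  using assms of_nat_eq_iff_cong_CHAR[of m n, where 'a = 'f] by simp

text \<open>Reduced modulo \<open>p\<close>, \<open>f\<close> becomes an injective self-map of the
  finite set of representatives, hence a permutation of it.\<close>

lemma sum_residues_reindex:
  fixes p :: nat and h :: "int \<Rightarrow> 'a::comm_monoid_add"
  assumes p: "p > 0"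
    and per: "\<And>x y. [x = y] (mod int p) \<Longrightarrow> h x = h y"
    and inj: "\<And>x y. [f x = f y] (mod int p) \<Longrightarrow> [x = y] (mod int p)"
  shows "(\<Sum>x\<in>{0..<int p}. h (f x)) = (\<Sum>x\<in>{0..<int p}. h x)"
proof -
  let ?A = "{0..<int p}"
  have inj': "inj_on (\<lambda>x. f x mod int p) ?A"
  proof (rule inj_onI)
    fix x y assume "x \<in> ?A" "y \<in> ?A" "f x mod int p = f y mod int p"
    then show "x = y"
      using inj[of x y] by (auto simp: cong_def)
  qed
  have "(\<lambda>x. f x mod int p) ` ?A = ?A"
    by (rule endo_inj_surj) (use p inj' in auto)
  then have "(\<Sum>x\<in>?A. h x) = (\<Sum>x\<in>?A. h (f x mod int p))"
    using sum.reindex[OF inj', of h] by (simp add: o_def)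
  also have "\<dots> = (\<Sum>x\<in>?A. h (f x))"
    by (intro sum.cong refl per) (simp add: cong_def)
  finally show ?thesis by simp
qed

text \<open>\<open>chi_power_5\<close> places every value among 0 and the fourth roots of unity,
  which in characteristic 5 make up the prime field. \<open>square_nontrivial\<close> makes the
  order exactly 4.\<close>

locale quartic_character =
  fixes p :: nat and chi :: "int \<Rightarrow> 'f::field"
  assumes prime_p: "prime p"
    and chi_cong: "[x = y] (mod int p) \<Longrightarrow> chi x = chi y"
    and chi_mult: "chi (x * y) = chi x * chi y"
    and chi_eq_0_iff: "chi x = 0 \<longleftrightarrow> int p dvd x"
    and chi_power_5: "chi x ^ 5 = chi x"
    and chi_minus_1: "chi (-1) = -1"
    and square_nontrivial: "\<exists>r. chi r \<noteq> 0 \<and> chi r ^ 2 \<noteq> 1"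
begin

lemma p_gt_1: "p > 1"
  using prime_p prime_gt_1_nat by blast

lemma chi_0 [simp]: "chi 0 = 0"
  by (simp add: chi_eq_0_iff)

lemma chi_power_4: "chi x \<noteq> 0 \<Longrightarrow> chi x ^ 4 = 1"
  using chi_power_5[of x] by (simp add: eval_nat_numeral)

lemma chi_1 [simp]: "chi 1 = 1"
  using chi_mult[of 1 1] chi_eq_0_iff[of 1] p_gt_1 by auto

lemma chi_minus: "chi (-x) = - chi x"
  using chi_mult[of "-1" x] by (simp add: chi_minus_1)

lemma chi_power: "chi (x ^ n) = chi x ^ n"
  by (induction n) (auto simp: chi_mult)

lemma cong_mult_cancel:
  assumes "chi c \<noteq> 0" "[c * x = c * y] (mod int p)"
  shows "[x = y] (mod int p)"
proof -
  have "coprime c (int p)"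
    using assms(1) prime_p by (metis chi_eq_0_iff coprime_commute prime_imp_coprime prime_nat_int_transfer)
  then show ?thesis
    using assms(2) by (simp add: cong_mult_lcancel)
qed

text \<open>Orthogonality: replacing \<open>x\<close> by \<open>r * x\<close> multiplies the sum by
  \<open>chi r ^ i\<close>, which differs from 1.\<close>

lemma sum_chi_power_eq_0:
  assumes "i \<in> {1,2,3}"
  shows "(\<Sum>x\<in>{0..<int p}. chi x ^ i) = 0"
proof -
  obtain r where r: "chi r \<noteq> 0" "chi r ^ 2 \<noteq> 1"
    using square_nontrivial by blast
  have r4: "chi r ^ 4 = 1" by (rule chi_power_4) fact
  have nt: "chi r ^ i \<noteq> 1"
  proof
    assume h: "chi r ^ i = 1"
    have "chi r ^ 2 = 1"
      using assms r r4 h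
      by (elim insertE) (auto simp: eval_nat_numeral)
    then show False using r by simp
  qed
  have "(\<Sum>x\<in>{0..<int p}. chi x ^ i) = (\<Sum>x\<in>{0..<int p}. chi (r * x) ^ i)"
    by (rule sum_residues_reindex[symmetric])
       (use p_gt_1 chi_cong cong_mult_cancel[OF r(1)] in \<open>auto dest: chi_cong\<close>)
  also have "\<dots> = chi r ^ i * (\<Sum>x\<in>{0..<int p}. chi x ^ i)"
    by (simp add: chi_mult power_mult_distrib sum_distrib_left)
  finally show ?thesis
    using nt by (metis mult_cancel_right mult_1)
qed

section \<open>Jacobi sums\<close>

text \<open>Up to the sign \<open>(-1) ^ i\<close> this is the classical Jacobi sum, with
  \<open>x + 1\<close> in place of \<open>1 - x\<close> to match the shift by 1. The trivial
  character has exponent 4, because \<open>0 ^ 0 = 1\<close>.\<close>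

definition jac :: "nat \<Rightarrow> nat \<Rightarrow> 'f" where
  "jac i j = (\<Sum>x\<in>{0..<int p}. chi x ^ i * chi (x + 1) ^ j)"

text \<open>The substitution of \<open>-1 - x\<close> for \<open>x\<close> exchanges
  \<open>x\<close> and \<open>x + 1\<close> up to sign, and \<open>chi (-1) = -1\<close>.\<close>

lemma jac_swap: "jac i j = (-1) ^ (i + j) * jac j i"
proof -
  have "jac i j = (\<Sum>x\<in>{0..<int p}. chi (-1 - x) ^ i * chi ((-1 - x) + 1) ^ j)"
    unfolding jac_def
    by (rule sum_residues_reindex[symmetric, where f = "\<lambda>x. -1 - x"])
       (use p_gt_1 in \<open>auto simp: cong_iff_dvd_diff intro!: arg_cong2[where f = "\<lambda>a b. a ^ i * b ^ j"] chi_cong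
          simp: dvd_diff_commute\<close>)
  also have "\<dots> = (\<Sum>x\<in>{0..<int p}. (-1) ^ (i + j) * (chi x ^ j * chi (x + 1) ^ i))"
  proof (intro sum.cong refl)
    fix x
    have "chi (-1 - x) = - chi (x + 1)"
      using chi_minus[of "x + 1"] by (simp add: algebra_simps)
    moreover have "chi ((-1 - x) + 1) = - chi x"
      using chi_minus[of x] by simp
    ultimately show "chi (-1 - x) ^ i * chi ((-1 - x) + 1) ^ j =
      (-1) ^ (i + j) * (chi x ^ j * chi (x + 1) ^ i)"
      by (simp only: power_minus[of "chi _"] power_add mult_ac)
  qed
  finally show ?thesis
    by (simp add: jac_def sum_distrib_left)
qed

lemma jac_shift: "jac i j = (\<Sum>w\<in>{0..<int p}. chi (w - 1) ^ i * chi w ^ j)"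
proof -
  let ?h = "\<lambda>w. chi (w - 1) ^ i * chi w ^ j"
  have "(\<Sum>x\<in>{0..<int p}. ?h (x + 1)) = (\<Sum>w\<in>{0..<int p}. ?h w)"
  proof (rule sum_residues_reindex)
    fix x y assume "[x = y] (mod int p)"
    then show "?h x = ?h y"
      using chi_cong[of x y] chi_cong[of "x - 1" "y - 1"] by (simp add: cong_diff)
  qed (use p_gt_1 in \<open>auto simp: cong_iff_dvd_diff\<close>)
  then show ?thesis by (simp add: jac_def)
qed

text \<open>The substitution replaces \<open>x + 1\<close> by its inverse modulo \<open>p\<close>.\<close>
lemma jac_invert:
  assumes "j > 0" "k > 0" "4 dvd i + j + k"
  shows "jac i j = (-1) ^ i * jac i k"
proof -
  have "\<exists>v. chi w \<noteq> 0 \<longrightarrow> [w * v = 1] (mod int p)" for w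
  proof (cases "chi w = 0")
    case False
    then have "coprime w (int p)"
      using prime_p by (metis chi_eq_0_iff coprime_commute prime_imp_coprime prime_nat_int_transfer)
    then show ?thesis
      using cong_solve_coprime_int by blast
  qed auto
  then obtain v where v: "chi w \<noteq> 0 \<Longrightarrow> [w * v w = 1] (mod int p)" for w
    by metis
  \<comment> \<open>The value 0 at multiples of \<open>p\<close> keeps \<open>f\<close> injective
    modulo \<open>p\<close>.\<close>
  define f where "f w = (if chi w = 0 then 0 else v w)" for w
  have f: "[w * f w = 1] (mod int p)" "chi w * chi (f w) = 1" if "chi w \<noteq> 0" for w
  proof -
    show *: "[w * f w = 1] (mod int p)"
      using v[OF that] that by (simp add: f_def)
    show "chi w * chi (f w) = 1"
      using chi_cong[OF *] by (simp add: chi_mult)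
  qed
  have f_inj: "[x = y] (mod int p)" if h: "[f x = f y] (mod int p)" for x y
  proof (cases "chi x = 0 \<or> chi y = 0")
    case True
    then have "chi (f x) = 0"
      using chi_cong[OF h] by (auto simp: f_def)
    then have "chi x = 0 \<and> chi y = 0"
      using f(2)[of x] f(2)[of y] chi_cong[OF h] by auto
    then show ?thesis
      by (simp add: chi_eq_0_iff cong_iff_dvd_diff)
  next
    case False
    have "[x * (y * f y) = x * 1] (mod int p)"
      using f(1)[of y] False by (intro cong_mult) auto
    moreover have "[y * (x * f x) = y * 1] (mod int p)"
      using f(1)[of x] False by (intro cong_mult) auto
    moreover have "[y * (x * f x) = y * (x * f y)] (mod int p)"
      using h by (intro cong_mult) auto
    ultimately show ?thesis
      by (metis cong_sym cong_trans mult.left_commute mult.right_neutral)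
  qed
  let ?h = "\<lambda>j w. chi (w - 1) ^ i * chi w ^ j"
  have "(\<Sum>w\<in>{0..<int p}. ?h j (f w)) = (\<Sum>w\<in>{0..<int p}. ?h j w)"
  proof (rule sum_residues_reindex)
    fix x y assume "[x = y] (mod int p)"
    then show "?h j x = ?h j y"
      using chi_cong[of x y] chi_cong[of "x - 1" "y - 1"] by (simp add: cong_diff)
  qed (use p_gt_1 f_inj in auto)
  moreover have "?h j (f w) = (-1) ^ i * ?h k w" for w
  proof (cases "chi w = 0")
    case True
    then show ?thesis
      using assms by (simp add: f_def power_0_left)
  next
    case False
    define c where "c = chi w"
    define d where "d = chi (f w)"
    have cd: "c * d = 1"
      using f(2)[OF False] by (simp add: c_def d_def)
    have "[w * (f w - 1) = - (w - 1)] (mod int p)"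
      using cong_diff[OF f(1)[OF False] cong_refl[of w]] by (simp add: algebra_simps)
    then have "c * chi (f w - 1) = - chi (w - 1)"
      using chi_cong[of "w * (f w - 1)" "- (w - 1)"] chi_minus[of "w - 1"] 
      by (simp only: chi_mult c_def)
    then have "d * (c * chi (f w - 1)) = - d * chi (w - 1)"
      by simp
    then have 1: "chi (f w - 1) = - d * chi (w - 1)"
      using cd by (simp add: mult.assoc[symmetric] mult.commute)
    \<comment> \<open>As \<open>d\<close> inverts \<open>c\<close> and \<open>c ^ 4 = 1\<close>, an
      exponent sum divisible by 4 trades \<open>d ^ (i + j)\<close> for
      \<open>c ^ k\<close>.\<close>
    obtain m where m: "i + j + k = 4 * m" using assms(3) by blast
    have "c ^ (i + j + k) = 1"
      using chi_power_4[OF False] by (simp add: m power_mult c_def)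
    then have "c ^ k * (c * d) ^ (i + j) = d ^ (i + j)"
      by (simp add: power_mult_distrib power_add algebra_simps)
    then have 2: "d ^ (i + j) = c ^ k"
      using cd by simp
    have "?h j (f w) = (- d * chi (w - 1)) ^ i * d ^ j"
      unfolding 1 d_def ..
    also have "\<dots> = (-1) ^ i * chi (w - 1) ^ i * d ^ (i + j)"
      by (simp only: power_mult_distrib power_add power_minus[of d] mult_ac)
    finally show ?thesis
      by (simp add: 2 c_def mult.assoc)
  qed
  ultimately show ?thesis
    by (simp add: jac_shift[of i j] jac_shift[of i k] sum_distrib_left)
qed

text \<open>\<open>chi (x + 1) ^ 4\<close> is 1 except at \<open>x = p - 1\<close>, where it
  vanishes; the lost term is \<open>chi (-1) ^ i\<close>.\<close>

lemma jac_4_right: "jac i 4 = (\<Sum>x\<in>{0..<int p}. chi x ^ i) - (-1) ^ i"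
proof -
  let ?A = "{0..<int p}"
  have mem: "int p - 1 \<in> ?A" using p_gt_1 by auto
  have "chi (int p - 1) = chi (-1)"
    by (rule chi_cong) (simp add: cong_iff_dvd_diff)
  then have m1: "chi (int p - 1) = -1" by (simp add: chi_minus_1)
  have nz: "chi (x + 1) ^ 4 = 1" if "x \<in> ?A - {int p - 1}" for x
  proof (rule chi_power_4)
    have "\<not> int p dvd x + 1"
      using that zdvd_not_zless[of "x + 1" "int p"] by auto
    then show "chi (x + 1) \<noteq> 0" by (simp add: chi_eq_0_iff)
  qed
  have "jac i 4 = (\<Sum>x\<in>?A - {int p - 1}. chi x ^ i * chi (x + 1) ^ 4)"
    unfolding jac_def by (subst sum.remove[OF _ mem]) (auto simp: chi_eq_0_iff)
  also have "\<dots> = (\<Sum>x\<in>?A - {int p - 1}. chi x ^ i)"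
    by (intro sum.cong refl) (simp only: nz mult_1_right)
  also have "\<dots> = (\<Sum>x\<in>?A. chi x ^ i) - chi (int p - 1) ^ i"
    by (subst sum.remove[OF _ mem]) auto
  finally show ?thesis
    by (simp add: m1)
qed

lemma sum_chi_power_4: "(\<Sum>x\<in>{0..<int p}. chi x ^ 4) = of_nat p - 1"
proof -
  have nz: "chi x ^ 4 = 1" if "x \<in> {0..<int p} - {0}" for x
  proof (rule chi_power_4)
    have "\<not> int p dvd x"
      using that zdvd_not_zless[of "x" "int p"] by auto
    then show "chi x \<noteq> 0" by (simp add: chi_eq_0_iff)
  qed
  have "(\<Sum>x\<in>{0..<int p}. chi x ^ 4) = (\<Sum>x\<in>{0..<int p} - {0}. chi x ^ 4)"
    using p_gt_1 by (subst sum.remove[of _ 0]) auto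
  also have "\<dots> = (\<Sum>x\<in>{0..<int p} - {0}. 1)"
    by (intro sum.cong refl nz)
  also have "\<dots> = of_nat p - 1"
    using p_gt_1 by (simp add: of_nat_diff)
  finally show ?thesis .
qed

section \<open>Counting by Jacobi sums\<close>

text \<open>In the prime field \<open>1 - w ^ 4\<close> detects \<open>w = 0\<close>, here for
  \<open>w = z - y - 1\<close>. Its monomials are padded with fourth powers until both
  \<open>y\<close> and \<open>z\<close> occur, so that each vanishes with \<open>y\<close> or
  \<open>z\<close> and sums to some \<open>jac i j\<close>.\<close>

lemma successor_indicator:
  fixes y z :: 'f
  assumes "CHAR('f) = 5" "y ^ 5 = y" "z ^ 5 = z"
  shows "(if y \<noteq> 0 \<and> z \<noteq> 0 \<and> z = y + 1 then 1 else 0) =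
     - 2 * (y^4 * z^4) - y * z^3 - y^2 * z^2 - y^3 * z - 2 * (y * z^2) - 3 * (y^2 * z) - 3 * (y * z)
     - y^4 * z^3 - y^4 * z^2 - y^4 * z + y * z^4 - y^2 * z^4 + y^3 * z^4"
proof (cases "y = 0 \<or> z = 0")
  case True
  then show ?thesis by auto
next
  case False
  have five: "(5::'f) = 0"
    using of_nat_CHAR[where 'a = 'f] assms(1) by simp
  have y4: "y ^ 4 = 1" and z4: "z ^ 4 = 1"
    using assms False by (simp_all add: eval_nat_numeral)
  define w where "w = z - y - 1"
  have "w ^ 5 = w"
  proof -
    have fd: "(a + b) ^ 5 = a ^ 5 + b ^ 5" for a b :: 'f
      by (rule freshmans_dream) (simp_all add: assms(1))
    have "w ^ 5 = (z + (- y + - 1)) ^ 5"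
      by (simp add: w_def algebra_simps)
    also have "\<dots> = z ^ 5 + (- y) ^ 5 + (-1) ^ 5"
      by (simp only: fd add.assoc)
    also have "\<dots> = w"
      by (simp add: assms w_def)
    finally show ?thesis .
  qed
  then have w: "w = 0 \<or> w ^ 4 = 1"
    by (auto simp: eval_nat_numeral)
  have ind: "(if y \<noteq> 0 \<and> z \<noteq> 0 \<and> z = y + 1 then 1 else 0) = 1 - w ^ 4"
    using w False by (auto simp: w_def algebra_simps)
  \<comment> \<open>Integer expansion of \<open>(z - y - 1) ^ 4\<close> with the multiples of 5 set
    apart.\<close>
  have "w ^ 4 = z^4 + z^3*y + z^3 + z^2*y^2 + 2*(z^2*y) + z^2 + z*y^3 + 3*(z*y^2) + 3*(z*y) + z
      + y^4 - y^3 + y^2 - y + 1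
      + 5 * (z^2 * y^2 + 2 * (z^2 * y) + z^2 + y^3 + y^2 + y
        - z^3 * y - z^3 - z * y^3 - 3 * (z * y^2) - 3 * (z * y) - z)"
    unfolding w_def by (simp add: eval_nat_numeral algebra_simps)
  then have "w ^ 4 = z^3*y + z^3 + z^2*y^2 + 2*(z^2*y) + z^2 + z*y^3 + 3*(z*y^2) + 3*(z*y) + z
      - y^3 + y^2 - y + 3"
    by (simp add: five y4 z4)
  then show ?thesis
    unfolding ind y4 z4 by (simp add: algebra_simps)
qed

text \<open>The indicator sums to thirteen Jacobi sums. Those with an exponent 4 or with exponents
  adding up to 4 are 1 or -1; the others are \<open>jac 1 2\<close> up to sign.\<close>

lemma card_successor_pairs:
  assumes "CHAR('f) = 5" "p mod 5 = 1"
  shows "of_nat (card {x \<in> {0..<int p}. chi x \<noteq> 0 \<and> chi (x + 1) \<noteq> 0 \<and> chi (x + 1) = chi x + 1})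
    = 1 - jac 1 2"
proof -
  have five: "(5::'f) = 0"
    using of_nat_CHAR[where 'a = 'f] assms(1) by simp
  have p1: "of_nat p = (1::'f)"
    using of_nat_eq_iff_mod_5[OF assms(1), of p 1] assms(2) by (simp add: cong_def)
  let ?P = "\<lambda>x. chi x \<noteq> 0 \<and> chi (x + 1) \<noteq> 0 \<and> chi (x + 1) = chi x + 1"
  have "of_nat (card {x \<in> {0..<int p}. ?P x}) = (\<Sum>x\<in>{0..<int p}. if ?P x then 1 else (0::'f))"
    by (simp add: sum.If_cases Int_def)
  also have "\<dots> = - 2 * jac 4 4 - jac 1 3 - jac 2 2 - jac 3 1 - 2 * jac 1 2 - 3 * jac 2 1 - 3 * jac 1 1
     - jac 4 3 - jac 4 2 - jac 4 1 + jac 1 4 - jac 2 4 + jac 3 4"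
    unfolding successor_indicator[OF assms(1) chi_power_5 chi_power_5]
    by (simp add: sum.distrib sum_subtractf jac_def sum_distrib_left sum_negf)
  also have "\<dots> = 11 + 4 * jac 1 2"
  proof -
    have e: "jac 1 4 = 1" "jac 2 4 = -1" "jac 3 4 = 1"
      using sum_chi_power_eq_0[of 1] by (simp_all add: jac_4_right sum_chi_power_eq_0)
    have "jac 4 1 = -1" "jac 4 2 = -1" "jac 4 3 = -1"
      using jac_swap[of 4 1] jac_swap[of 4 2] jac_swap[of 4 3] e by simp_all
    moreover have "jac 1 3 = -1" "jac 2 2 = -1"
      using jac_invert[of 3 4 1] jac_invert[of 2 4 2] e by simp_all
    moreover from this have "jac 3 1 = -1" 
      using jac_swap[of 3 1] by simp
    moreover have "jac 1 1 = - jac 1 2" using jac_invert[of 1 2 1] by (simp add: numeral_eq_Suc)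
    moreover have "jac 2 1 = - jac 1 2" using jac_swap[of 2 1] by simp
    moreover have "jac 4 4 = -1" by (simp add: jac_4_right sum_chi_power_4 p1)
    ultimately show ?thesis using e by simp
  qed
  also have "\<dots> = 1 - jac 1 2 + 5 * (2 + jac 1 2)" by (simp add: algebra_simps)
  finally show ?thesis by (simp add: five)
qed

end

section \<open>Gauss sums\<close>

locale quartic_gauss_sum = quartic_character p chi
  for p :: nat and chi :: "int \<Rightarrow> 'f::field" +
  fixes zeta :: 'f
  assumes zeta_power: "zeta ^ p = 1" and zeta_neq_1: "zeta \<noteq> 1"
begin

lemma zeta_neq_0: "zeta \<noteq> 0"
  using zeta_power p_gt_1 by (auto simp: power_0_left)

lemma zeta_powi_cong:
  assumes "[x = y] (mod int p)"
  shows "zeta powi x = zeta powi y"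
proof -
  obtain k where k: "x = y + int p * k"
    using assms by (metis cong_iff_lin cong_sym)
  have "zeta powi (int p * k) = 1"
    by (simp add: power_int_mult zeta_power)
  then show ?thesis
    by (simp add: k power_int_add zeta_neq_0)
qed

lemma sum_zeta: "(\<Sum>x\<in>{0..<int p}. zeta powi (c * x)) = (if int p dvd c then of_nat p else 0)"
proof (cases "int p dvd c")
  case True
  then have "zeta powi (c * x) = 1" for x
    using zeta_powi_cong[of "c * x" 0] by (simp add: cong_0_iff)
  then show ?thesis using True by simp
next
  case False
  \<comment> \<open>Shifting \<open>x\<close> by 1 multiplies this sum by
    \<open>zeta\<close>.\<close>
  have base: "(\<Sum>x\<in>{0..<int p}. zeta powi x) = 0"
  proof -
    let ?s = "\<Sum>x\<in>{0..<int p}. zeta powi x"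
    have "?s = (\<Sum>x\<in>{0..<int p}. zeta powi (x + 1))"
      by (rule sum_residues_reindex[symmetric])
         (use p_gt_1 zeta_powi_cong in \<open>auto simp: cong_iff_dvd_diff\<close>)
    also have "\<dots> = zeta * ?s"
      by (simp add: power_int_add zeta_neq_0 sum_distrib_left mult.commute)
    finally show ?thesis
      using zeta_neq_1 by (metis mult_cancel_right mult_1)
  qed
  have "(\<Sum>x\<in>{0..<int p}. zeta powi (c * x)) = (\<Sum>x\<in>{0..<int p}. zeta powi x)"
    by (rule sum_residues_reindex)
       (use p_gt_1 zeta_powi_cong cong_mult_cancel[of c] False chi_eq_0_iff in auto)
  then show ?thesis using base False by simp
qed

definition gauss :: "nat \<Rightarrow> 'f" where
  "gauss i = (\<Sum>x\<in>{0..<int p}. chi x ^ i * zeta powi x)"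

text \<open>Replacing \<open>x\<close> by \<open>c * x\<close> in \<open>gauss i\<close> extracts
  \<open>chi c ^ i\<close>, whose inverse is \<open>chi c ^ (4 - i)\<close>. If \<open>p\<close>
  divides \<open>c\<close>, both sides vanish, the left one by orthogonality.\<close>

lemma gauss_twist:
  assumes "i \<in> {1,2,3}"
  shows "(\<Sum>x\<in>{0..<int p}. chi x ^ i * zeta powi (c * x)) = chi c ^ (4 - i) * gauss i"
proof (cases "chi c = 0")
  case True
  then have "zeta powi (c * x) = 1" for x
    using zeta_powi_cong[of "c * x" 0] by (simp add: cong_0_iff chi_eq_0_iff)
  then show ?thesis
    using True assms sum_chi_power_eq_0[OF assms] by (auto simp: power_0_left)
next
  case False
  let ?s = "\<Sum>x\<in>{0..<int p}. chi x ^ i * zeta powi (c * x)"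
  have "gauss i = (\<Sum>x\<in>{0..<int p}. chi (c * x) ^ i * zeta powi (c * x))"
    unfolding gauss_def
  proof (rule sum_residues_reindex[symmetric])
    fix x y assume "[x = y] (mod int p)"
    then show "chi x ^ i * zeta powi x = chi y ^ i * zeta powi y"
      using chi_cong zeta_powi_cong by metis
  qed (use p_gt_1 cong_mult_cancel[OF False] in auto)
  also have "\<dots> = chi c ^ i * ?s"
    by (simp add: chi_mult power_mult_distrib sum_distrib_left mult.assoc)
  finally have "chi c ^ (4 - i) * gauss i = chi c ^ (4 - i + i) * ?s"
    by (simp add: power_add)
  also have "4 - i + i = 4" using assms by auto
  finally show ?thesis using chi_power_4[OF False] by simp
qed

text \<open>The second summation variable is written as \<open>x * t\<close>, a permutation of the
  residues when \<open>chi x\<close> is nonzero; otherwise the factor \<open>chi x ^ i\<close> with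
  \<open>i > 0\<close> removes the term.\<close>

lemma gauss_mult:
  assumes "i > 0"
  shows "gauss i * gauss j =
    (\<Sum>t\<in>{0..<int p}. chi t ^ j * (\<Sum>x\<in>{0..<int p}. chi x ^ (i + j) * zeta powi ((t + 1) * x)))"
proof -
  have *: "chi x ^ i * gauss j = (\<Sum>t\<in>{0..<int p}. chi t ^ j * chi x ^ (i + j) * zeta powi (t * x))" for x
  proof (cases "chi x = 0")
    case True
    then show ?thesis using assms by (simp add: power_0_left)
  next
    case False
    have "gauss j = (\<Sum>t\<in>{0..<int p}. chi (x * t) ^ j * zeta powi (x * t))"
      unfolding gauss_def
    proof (rule sum_residues_reindex[symmetric])
      fix u v assume "[u = v] (mod int p)"
      then show "chi u ^ j * zeta powi u = chi v ^ j * zeta powi v"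
        using chi_cong zeta_powi_cong by metis
    qed (use p_gt_1 cong_mult_cancel[OF False] in auto)
    then show ?thesis
      by (simp add: chi_mult power_mult_distrib sum_distrib_left power_add mult_ac)
  qed
  have "gauss i * gauss j = (\<Sum>x\<in>{0..<int p}. zeta powi x * (chi x ^ i * gauss j))"
    by (simp add: gauss_def[of i] sum_distrib_right sum_distrib_left mult_ac)
  also have "\<dots> = (\<Sum>x\<in>{0..<int p}. \<Sum>t\<in>{0..<int p}. chi t ^ j * (chi x ^ (i + j) * zeta powi ((t + 1) * x)))"
    unfolding * by (simp add: sum_distrib_left power_int_add zeta_neq_0 distrib_left mult_ac)
  also have "\<dots> = (\<Sum>t\<in>{0..<int p}. \<Sum>x\<in>{0..<int p}. chi t ^ j * (chi x ^ (i + j) * zeta powi ((t + 1) * x)))"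
    by (rule sum.swap)
  finally show ?thesis by (simp add: sum_distrib_left)
qed

text \<open>The inner sum of \<open>gauss_mult\<close> is \<open>gauss 2\<close> twisted by
  \<open>t + 1\<close>, and the factor \<open>chi (t + 1) ^ 2\<close> completes the Jacobi
  sum.\<close>

lemma gauss_1_square: "gauss 1 ^ 2 = jac 1 2 * gauss 2"
proof -
  have "gauss 1 ^ 2 = (\<Sum>t\<in>{0..<int p}. chi t ^ 1 * (\<Sum>x\<in>{0..<int p}. chi x ^ 2 * zeta powi ((t + 1) * x)))"
    using gauss_mult[of 1 1] by (simp add: power2_eq_square numeral_2_eq_2)
  also have "\<dots> = jac 1 2 * gauss 2"
    by (subst gauss_twist) (simp_all add: jac_def sum_distrib_right mult.assoc)
  finally show ?thesis .
qed

lemma gauss_3_square: "gauss 3 ^ 2 = jac 3 2 * gauss 2"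
proof -
  have "chi x ^ 6 = chi x ^ 2" for x
    using chi_power_5[of x] by (simp add: eval_nat_numeral)
  then have "gauss 3 ^ 2 = (\<Sum>t\<in>{0..<int p}. chi t ^ 3 * (\<Sum>x\<in>{0..<int p}. chi x ^ 2 * zeta powi ((t + 1) * x)))"
    using gauss_mult[of 3 3] by (simp add: power2_eq_square)
  also have "\<dots> = jac 3 2 * gauss 2"
    by (subst gauss_twist) (simp_all add: jac_def sum_distrib_right mult.assoc)
  finally show ?thesis .
qed

text \<open>The product character is trivial, so the inner sum of \<open>gauss_mult\<close> is -1,
  plus \<open>p\<close> at \<open>t = p - 1\<close>. The contributions of -1 cancel by
  orthogonality.\<close>

lemma gauss_mult_conjugate:
  assumes "i \<in> {1,2,3}" "i + j = 4"
  shows "gauss i * gauss j = (-1) ^ j * of_nat p"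
proof -
  let ?A = "{0..<int p}"
  have j: "j \<in> {1,2,3}" using assms by auto
  have inner: "(\<Sum>x\<in>?A. chi x ^ 4 * zeta powi (c * x)) = (if int p dvd c then of_nat p else 0) - 1" for c
  proof -
    have c4: "chi x ^ 4 = 1" if "x \<in> ?A - {0}" for x
    proof (rule chi_power_4)
      have "\<not> int p dvd x"
        using that zdvd_not_zless[of "x" "int p"] by auto
      then show "chi x \<noteq> 0" by (simp add: chi_eq_0_iff)
    qed
    have "(\<Sum>x\<in>?A. chi x ^ 4 * zeta powi (c * x)) = (\<Sum>x\<in>?A - {0}. chi x ^ 4 * zeta powi (c * x))"
      using p_gt_1 by (subst sum.remove[of _ 0]) auto
    also have "\<dots> = (\<Sum>x\<in>?A - {0}. zeta powi (c * x))"
      by (intro sum.cong refl) (simp only: c4 mult_1)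
    also have "\<dots> = (\<Sum>x\<in>?A. zeta powi (c * x)) - 1"
      using p_gt_1 by (subst (2) sum.remove[of _ 0]) auto
    finally show ?thesis by (simp add: sum_zeta)
  qed
  have dvd: "int p dvd t + 1 \<longleftrightarrow> t = int p - 1" if "t \<in> ?A" for t
    using that zdvd_imp_le[of "int p" "t + 1"] by auto
  have "chi (int p - 1) = chi (-1)"
    by (rule chi_cong) (simp add: cong_iff_dvd_diff)
  then have m1: "chi (int p - 1) = -1" by (simp add: chi_minus_1)
  have "gauss i * gauss j = (\<Sum>t\<in>?A. chi t ^ j * ((if int p dvd t + 1 then of_nat p else 0) - 1))"
    using assms by (subst gauss_mult) (auto simp: inner)
  also have "\<dots> = (\<Sum>t\<in>?A. if t = int p - 1 then chi t ^ j * of_nat p else 0) - (\<Sum>t\<in>?A. chi t ^ j)"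
    unfolding sum_subtractf[symmetric] by (intro sum.cong refl) (auto simp: dvd algebra_simps)
  also have "\<dots> = (-1) ^ j * of_nat p"
    using p_gt_1 sum_chi_power_eq_0[OF j] by (simp add: sum.delta m1)
  finally show ?thesis .
qed

text \<open>Frobenius fixes the values of \<open>chi\<close> and sends \<open>zeta\<close> to
  \<open>zeta ^ 5\<close>, so it twists \<open>gauss 1\<close> by 5. This evaluates
  \<open>gauss 1 ^ 4\<close>, which is also \<open>jac 1 2 ^ 2 * gauss 2 ^ 2\<close>, where
  \<open>gauss 2 ^ 2\<close> is 1.\<close>

lemma jac_1_2_identities:
  assumes "CHAR('f) = 5" "p mod 5 = 1"
  shows "jac 1 2 ^ 2 = chi 5 ^ 3"
    and "jac 1 2 * jac 3 2 = 1"
proof -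
  have p1: "of_nat p = (1::'f)"
    using of_nat_eq_iff_mod_5[OF assms(1), of p 1] assms(2) by (simp add: cong_def)
  have g13: "gauss 1 * gauss 3 = -1"
    using gauss_mult_conjugate[of 1 3] p1 by simp
  have g22: "gauss 2 ^ 2 = 1"
    using gauss_mult_conjugate[of 2 2] p1 by (simp add: power2_eq_square)
  have "gauss 1 ^ 5 = (\<Sum>x\<in>{0..<int p}. (chi x ^ 1 * zeta powi x) ^ 5)"
    unfolding gauss_def by (rule freshmans_dream_sum) (simp_all add: assms(1))
  also have "\<dots> = (\<Sum>x\<in>{0..<int p}. chi x ^ 1 * zeta powi (5 * x))"
    by (intro sum.cong refl) (simp add: power_mult_distrib chi_power_5 power_int_mult mult.commute[of 5])
  also have "\<dots> = chi 5 ^ 3 * gauss 1"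
    by (subst gauss_twist) simp_all
  finally have "gauss 1 ^ 5 = chi 5 ^ 3 * gauss 1" .
  \<comment> \<open>Cancels \<open>gauss 1\<close>, nonzero by \<open>g13\<close>.\<close>
  then have "gauss 1 ^ 4 = chi 5 ^ 3"
    using g13 by (auto simp: eval_nat_numeral)
  moreover have "gauss 1 ^ 4 = (gauss 1 ^ 2) ^ 2" by simp
  ultimately show "jac 1 2 ^ 2 = chi 5 ^ 3"
    unfolding gauss_1_square by (simp only: power_mult_distrib g22 mult_1_right)
  have "jac 1 2 * jac 3 2 * gauss 2 ^ 2 = (gauss 1 * gauss 3) ^ 2"
    unfolding power_mult_distrib gauss_1_square gauss_3_square by (simp add: power2_eq_square mult_ac)
  then show "jac 1 2 * jac 3 2 = 1"
    by (simp only: g13 g22) simp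
qed

end

text \<open>The cube is the inverse character; passing to it replaces \<open>jac 1 2\<close> by
  \<open>jac 3 2\<close>.\<close>

lemma (in quartic_character) quartic_character_cube: "quartic_character p (\<lambda>x. chi x ^ 3)"
proof
  fix x y
  show "prime p" by (rule prime_p)
  show "[x = y] (mod int p) \<Longrightarrow> chi x ^ 3 = chi y ^ 3"
    using chi_cong by metis
  show "chi (x * y) ^ 3 = chi x ^ 3 * chi y ^ 3"
    by (simp add: chi_mult power_mult_distrib)
  show "chi x ^ 3 = 0 \<longleftrightarrow> int p dvd x"
    by (simp add: chi_eq_0_iff)
  have "(chi x ^ 3) ^ 5 = (chi x ^ 5) ^ 3"
    by (simp flip: power_mult)
  then show "(chi x ^ 3) ^ 5 = chi x ^ 3"
    by (simp add: chi_power_5)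
  show "chi (-1) ^ 3 = -1"
    by (simp add: chi_minus_1)
  obtain r where r: "chi r \<noteq> 0" "chi r ^ 2 \<noteq> 1"
    using square_nontrivial by blast
  have "(chi r ^ 3) ^ 2 = chi r ^ 4 * chi r ^ 2"
    by (simp flip: power_mult power_add)
  then show "\<exists>r. chi r ^ 3 \<noteq> 0 \<and> (chi r ^ 3) ^ 2 \<noteq> 1"
    using r chi_power_4[OF r(1)] by auto
qed

text \<open>The sum of \<open>z ^ k\<close> for \<open>k < p\<close> divides
  \<open>z ^ p - 1\<close> and takes the nonzero value \<open>p\<close> at 1, so any root of it
  works.\<close>

lemma ex_nontrivial_root_of_unity:
  fixes p :: nat
  assumes "p > 1" "of_nat p \<noteq> (0 :: 'f::alg_closed_field)"
  shows "\<exists>z::'f. z ^ p = 1 \<and> z \<noteq> 1"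
proof -
  obtain z :: 'f where z: "(\<Sum>k\<le>p - 1. 1 * z ^ k) = 0"
    using alg_closed[of "p - 1" "\<lambda>_. 1 :: 'f"] assms(1) by auto
  have "{..p - 1} = {..<p}" using assms(1) by auto
  then have s: "(\<Sum>k<p. z ^ k) = 0" using z by simp
  then have "z ^ p = 1"
    using one_diff_power_eq[of z p] by simp
  moreover have "z \<noteq> 1" using s assms(2) by auto
  ultimately show ?thesis by blast
qed

section \<open>The quartic character attached to a primitive root\<close>

lemma primroot_power_surj:
  fixes p g :: nat
  assumes "prime p" "ord p g = p - 1" "\<not> int p dvd x"
  shows "\<exists>j<p - 1. [int g ^ j = x] (mod int p)"
proof -
  have p: "p > 1" using assms(1) prime_gt_1_nat by blast
  have "coprime p g" using assms(2) p by (metis ord_eq_0 zero_less_diff less_numeral_extra(3))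
  then have "residue_primroot p g"
    using assms p by (simp add: residue_primroot_def totient_prime)
  then have b: "bij_betw (\<lambda>i. g ^ i mod p) {..<totient p} (totatives p)"
    using residue_primroot_is_generator p by blast
  have m: "nat (x mod int p) \<in> totatives p"
  proof -
    have "x mod int p > 0" "x mod int p < int p"
      using assms(3) p pos_mod_bound[of "int p" x] pos_mod_sign[of "int p" x]
      by (auto simp: dvd_eq_mod_eq_0 order_less_le)
    then have "nat (x mod int p) \<in> {0<..<p}" by auto
    then show ?thesis using totatives_prime[OF assms(1)] by simp
  qed
  then have "nat (x mod int p) \<in> (\<lambda>i. g ^ i mod p) ` {..<p - 1}"
    using b totient_prime[OF assms(1)] by (simp add: bij_betw_def)
  then obtain j where j: "j < p - 1" "g ^ j mod p = nat (x mod int p)"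
    by force
  then have "int (g ^ j mod p) = x mod int p"
    using p by simp
  then show ?thesis
    using j(1) by (auto simp: cong_def zmod_int)
qed

lemma primroot_half_power:
  fixes p g :: nat
  assumes "prime p" "odd p" "ord p g = p - 1"
  shows "[int g ^ ((p - 1) div 2) = -1] (mod int p)"
proof -
  have p: "p > 2" using prime_ge_2_nat[OF assms(1)] assms(2) by (cases "p = 2") auto
  let ?h = "(p - 1) div 2"
  have h: "?h + ?h = p - 1" using assms(2) by presburger
  have "[g ^ (p - 1) = 1] (mod p)" using ord[of g p] assms(3) by simp
  then have "[int g ^ (p - 1) = 1] (mod int p)"
    by (metis cong_int_iff of_nat_1 of_nat_power)
  moreover have "int g ^ (p - 1) = int g ^ ?h * int g ^ ?h"
    using h by (metis power_add)
  ultimately have "int p dvd (int g ^ ?h - 1) * (int g ^ ?h + 1)"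
    by (simp add: cong_iff_dvd_diff algebra_simps)
  then have "int p dvd int g ^ ?h - 1 \<or> int p dvd int g ^ ?h + 1"
    using assms(1) prime_dvd_mult_iff by (metis prime_nat_int_transfer)
  moreover have "\<not> int p dvd int g ^ ?h - 1"
  proof
    assume "int p dvd int g ^ ?h - 1"
    then have "[g ^ ?h = 1] (mod p)"
      by (metis cong_iff_dvd_diff cong_int_iff of_nat_1 of_nat_power)
    then have "p - 1 dvd ?h" using ord_divides assms(3) by metis
    then show False using p h by (auto dest!: dvd_imp_le)
  qed
  ultimately show ?thesis by (simp add: cong_iff_dvd_diff)
qed

text \<open>In characteristic 5 the element 2 has order 4, and 4 divides \<open>p - 1\<close>; so 2
  raised to the discrete logarithm to base \<open>g\<close> is well defined.\<close>

lemma ex_quartic_character: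
  fixes p g :: nat
  assumes p: "prime p" and g: "ord p g = p - 1" and p8: "p mod 8 = 5" and char: "CHAR('f::field) = 5"
  shows "\<exists>chi :: int \<Rightarrow> 'f. quartic_character p chi \<and> (\<forall>j. chi (int g ^ j) = 2 ^ j)"
proof -
  have p1: "p > 1" using p prime_gt_1_nat by blast
  have five: "(5::'f) = 0"
    using of_nat_CHAR[where 'a = 'f] char by simp
  have two4: "(2::'f) ^ 4 = 1"
  proof -
    have "(2::'f) ^ 4 = 1 + 5 * 3" by simp
    then show ?thesis by (simp only: five) simp
  qed
  have ndvd: "\<not> int p dvd int g ^ j" for j
  proof
    assume "int p dvd int g ^ j"
    then have "p dvd g" using p
      by (metis int_dvd_int_iff of_nat_power prime_dvd_power)
    then show False using g p1
      by (metis coprime_absorb_left ord_eq_0 not_prime_unit p zero_less_diff less_numeral_extra(3))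
  qed
  define chi :: "int \<Rightarrow> 'f" where
    "chi x = (if int p dvd x then 0 else 2 ^ (SOME j. [int g ^ j = x] (mod int p)))" for x
  have key: "chi x = 2 ^ j" if "[int g ^ j = x] (mod int p)" for x j
  proof -
    have nx: "\<not> int p dvd x" using that ndvd[of j] cong_dvd_iff by blast
    define i where "i = (SOME j. [int g ^ j = x] (mod int p))"
    have "[int g ^ i = x] (mod int p)"
      unfolding i_def by (rule someI) (rule that)
    then have "[int g ^ i = int g ^ j] (mod int p)"
      using that cong_trans cong_sym by blast
    then have "[g ^ i = g ^ j] (mod p)"
      by (metis cong_int_iff of_nat_power)
    then have "[i = j] (mod (p - 1))"
      using order_divides_expdiff[of p g i j] g p1
      by (metis ord_eq_0 zero_less_diff less_numeral_extra(3))
    moreover have "4 dvd p - 1" using p8 by presburger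
    ultimately have "i mod 4 = j mod 4"
      by (metis cong_def cong_dvd_modulus_nat)
    moreover have "(2::'f) ^ k = 2 ^ (k mod 4)" for k
    proof -
      have "(2::'f) ^ k = 2 ^ (4 * (k div 4) + k mod 4)" by simp
      then show ?thesis by (simp only: power_add power_mult two4) simp
    qed
    ultimately have "(2::'f) ^ i = 2 ^ j" by metis
    then show ?thesis using nx by (simp add: chi_def i_def)
  qed
  have surj: "\<exists>j. [int g ^ j = x] (mod int p)" if "\<not> int p dvd x" for x
    using primroot_power_surj[OF p g that] by blast
  have two: "(2::'f) \<noteq> 0"
    using of_nat_eq_iff_mod_5[OF char, of 2 0] by (simp add: cong_def)
  have "quartic_character p chi"
  proof
    fix x y
    show "prime p" by (rule p)
    show zero: "chi x = 0 \<longleftrightarrow> int p dvd x" for x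
      using two by (simp add: chi_def)
    show "chi x = chi y" if "[x = y] (mod int p)"
    proof (cases "int p dvd x")
      case True
      then have "int p dvd y" using that cong_dvd_iff by blast
      then show ?thesis using True by (simp add: chi_def)
    next
      case False
      then obtain j where "[int g ^ j = x] (mod int p)" using surj by blast
      then show ?thesis using that key cong_trans by metis
    qed
    show "chi (x * y) = chi x * chi y"
    proof (cases "int p dvd x \<or> int p dvd y")
      case True
      then show ?thesis by (auto simp: chi_def)
    next
      case False
      then obtain i j where ij: "[int g ^ i = x] (mod int p)" "[int g ^ j = y] (mod int p)"
        using surj by blast
      then have "[int g ^ (i + j) = x * y] (mod int p)"
        unfolding power_add by (rule cong_mult)
      then show ?thesis using key ij by (metis power_add)
    qed
    show "chi x ^ 5 = chi x"
    proof (cases "int p dvd x")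
      case True
      then show ?thesis by (simp add: chi_def)
    next
      case False
      then obtain j where j: "chi x = 2 ^ j" using surj key by blast
      have "chi x ^ 5 = (2 ^ 4) ^ j * 2 ^ j"
        unfolding j by (simp only: power_mult[symmetric] power_add[symmetric]) (simp add: algebra_simps)
      then show ?thesis using j by (simp only: two4) simp
    qed
    show "chi (-1) = -1"
    proof -
      have "chi (-1) = 2 ^ ((p - 1) div 2)"
        by (rule key, rule primroot_half_power) (use p g p8 in presburger)+
      \<comment> \<open>Because \<open>p mod 8 = 5\<close>, the logarithm of -1 is 2 modulo 4, and
        \<open>2 ^ 2 = -1\<close> in the field.\<close>
      also have "(p - 1) div 2 = 4 * (p div 8) + 2" using p8 by presburger
      also have "(2::'f) ^ \<dots> = 2 ^ 2" by (simp only: power_add power_mult two4) simp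
      also have "\<dots> = -1 + 5" by simp
      finally show ?thesis by (simp only: five) simp
    qed
    have "chi (int g) = 2" using key[of 1 "int g"] by simp
    moreover have "(2::'f) ^ 2 \<noteq> 1"
      using of_nat_eq_iff_mod_5[OF char, of 4 1] by (simp add: cong_def)
    ultimately show "\<exists>r. chi r \<noteq> 0 \<and> chi r ^ 2 \<noteq> 1"
      using two by metis
  qed
  moreover have "\<forall>j. chi (int g ^ j) = 2 ^ j"
    using key[OF cong_refl] by simp
  ultimately show ?thesis by blast
qed

section \<open>The set S as the graph of the character\<close>

text \<open>By the Chinese remainder theorem an element of S is a pair of residues modulo
  \<open>p\<close> and 5, and \<open>chi_a\<close> makes the second one \<open>chi\<close> of the
  first. So S is the graph of \<open>chi\<close> over the nonzero residues modulo
  \<open>p\<close>.\<close>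

lemma (in quartic_character) mem_S_set_iff:
  assumes char: "CHAR('f) = 5" and p5: "p \<noteq> 5" and a: "ord p a = p - 1"
    and chi_a: "\<And>j. chi (int a ^ j) = of_nat (a ^ j)"
  shows "m \<in> S_set (5 * p) p a \<longleftrightarrow> m < 5 * p \<and> chi (int m) \<noteq> 0 \<and> of_nat m = chi (int m)"
proof
  assume "m \<in> S_set (5 * p) p a"
  then obtain j where j: "m = a ^ j mod (5 * p)"
    by (auto simp: S_set_def)
  have "[m = a ^ j] (mod 5)" "[m = a ^ j] (mod p)"
    unfolding j by (simp_all add: cong_def mod_mod_cancel)
  then have "of_nat m = (of_nat (a ^ j) :: 'f)" "[int m = int a ^ j] (mod int p)"
    using of_nat_eq_iff_mod_5[OF char] by (auto simp flip: of_nat_power simp: cong_int_iff)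
  then have eq: "of_nat m = chi (int m)"
    using chi_a chi_cong by metis
  have "coprime a p" using a p_gt_1 by (metis coprime_commute ord_eq_0 zero_less_diff less_numeral_extra(3))
  then have "chi (int a) \<noteq> 0"
    using p_gt_1 chi_eq_0_iff[of "int a"] by (auto simp: coprime_commute coprime_absorb_left)
  then have "chi (int m) \<noteq> 0"
    using chi_cong[OF \<open>[int m = int a ^ j] (mod int p)\<close>] by (simp add: chi_power)
  then show "m < 5 * p \<and> chi (int m) \<noteq> 0 \<and> of_nat m = chi (int m)"
    using eq j p_gt_1 by simp
next
  assume m: "m < 5 * p \<and> chi (int m) \<noteq> 0 \<and> of_nat m = chi (int m)"
  then obtain j where j: "j < p - 1" "[int a ^ j = int m] (mod int p)"
    using primroot_power_surj[OF prime_p a] chi_eq_0_iff by blast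
  have "of_nat (a ^ j) = (of_nat m :: 'f)"
    using m chi_cong[OF j(2)] chi_a by metis
  then have "[a ^ j = m] (mod 5)"
    using of_nat_eq_iff_mod_5[OF char] by blast
  moreover have "[a ^ j = m] (mod p)"
    using j(2) by (simp flip: of_nat_power add: cong_int_iff)
  moreover have "coprime 5 p"
    using p5 prime_p primes_coprime[of 5 p] by simp
  ultimately have "[a ^ j = m] (mod (5 * p))"
    by (rule coprime_cong_mult_nat)
  then have "m = a ^ j mod (5 * p)"
    using m by (simp add: cong_def)
  then show "m \<in> S_set (5 * p) p a"
    using j(1) by (auto simp: S_set_def)
qed

text \<open>The intersection corresponds to the \<open>s\<close> in S whose successor lies in S. In
  a graph such an \<open>s\<close> is determined by its residue modulo \<open>p\<close>.\<close>

lemma (in quartic_character) card_S_set_Int_shift: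
  assumes char: "CHAR('f) = 5" and p5: "p \<noteq> 5" and a: "ord p a = p - 1"
    and chi_a: "\<And>j. chi (int a ^ j) = of_nat (a ^ j)"
  shows "card (S_set (5 * p) p a \<inter> shift1 (5 * p) (S_set (5 * p) p a)) =
    card {x \<in> {0..<int p}. chi x \<noteq> 0 \<and> chi (x + 1) \<noteq> 0 \<and> chi (x + 1) = chi x + 1}"
proof -
  define S where "S = S_set (5 * p) p a"
  have S: "m \<in> S \<longleftrightarrow> m < 5 * p \<and> chi (int m) \<noteq> 0 \<and> of_nat m = chi (int m)" for m
    unfolding S_def by (rule mem_S_set_iff[OF char p5 a chi_a])
  have cop: "coprime 5 p"
    using p5 prime_p primes_coprime[of 5 p] by simp
  define R where "R = {s \<in> S. (s + 1) mod (5 * p) \<in> S}"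
  define Y where "Y = {x \<in> {0..<int p}. chi x \<noteq> 0 \<and> chi (x + 1) \<noteq> 0 \<and> chi (x + 1) = chi x + 1}"
  have succ: "(s + 1) mod (5 * p) \<in> S \<longleftrightarrow> chi (int s + 1) \<noteq> 0 \<and> chi (int s + 1) = chi (int s) + 1"
    if "s \<in> S" for s
  proof -
    let ?t = "(s + 1) mod (5 * p)"
    have "[?t = s + 1] (mod 5)" "[?t = s + 1] (mod p)"
      by (simp_all add: cong_def mod_mod_cancel)
    then have "of_nat ?t = (of_nat (s + 1) :: 'f)" "[int ?t = int (s + 1)] (mod int p)"
      using of_nat_eq_iff_mod_5[OF char] cong_int_iff by blast+
    then have "of_nat ?t = chi (int s) + 1" "chi (int ?t) = chi (int s + 1)"
      using that S[of s] chi_cong[of "int ?t" "int (s + 1)"] by (simp_all only: of_nat_add of_nat_1)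
    then show ?thesis
      using S[of ?t] p_gt_1 by (auto simp del: of_nat_mod)
  qed
  have "S \<inter> shift1 (5 * p) S = (\<lambda>s. (s + 1) mod (5 * p)) ` R"
    by (auto simp: R_def shift1_def)
  moreover have "inj_on (\<lambda>s. (s + 1) mod (5 * p)) R"
  proof (rule inj_onI)
    fix s t assume st: "s \<in> R" "t \<in> R" "(s + 1) mod (5 * p) = (t + 1) mod (5 * p)"
    then have "[s + 1 = t + 1] (mod 5 * p)" by (simp only: cong_def)
    then have "[s = t] (mod 5 * p)" by (simp only: cong_add_rcancel_nat)
    moreover have "s < 5 * p" "t < 5 * p" using st S unfolding R_def by blast+
    ultimately show "s = t" using cong_less_modulus_unique_nat by blast
  qed
  ultimately have card_R: "card (S \<inter> shift1 (5 * p) S) = card R"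
    by (simp only: card_image)
  have "bij_betw (\<lambda>s. int s mod int p) R Y"
  proof (rule bij_betwI')
    fix s t assume st: "s \<in> R" "t \<in> R"
    show "(int s mod int p = int t mod int p) = (s = t)"
    proof
      assume h: "int s mod int p = int t mod int p"
      then have "chi (int s) = chi (int t)" by (intro chi_cong) (simp add: cong_def)
      then have "of_nat s = (of_nat t :: 'f)" using st S by (simp add: R_def)
      then have "[s = t] (mod 5)" using of_nat_eq_iff_mod_5[OF char] by blast
      moreover have "[s = t] (mod p)" using h by (simp add: cong_def flip: of_nat_mod)
      ultimately have "[s = t] (mod 5 * p)" using cop by (rule coprime_cong_mult_nat)
      moreover have "s < 5 * p" "t < 5 * p" using st S unfolding R_def by blast+
      ultimately show "s = t" using cong_less_modulus_unique_nat by blast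
    qed simp
  next
    fix s assume s: "s \<in> R"
    have "chi (int s mod int p) = chi (int s)" "chi (int s mod int p + 1) = chi (int s + 1)"
      by (rule chi_cong, simp add: cong_def mod_simps)+
    moreover have "s \<in> S" "chi (int s + 1) \<noteq> 0" "chi (int s + 1) = chi (int s) + 1"
      using s succ unfolding R_def by blast+
    ultimately show "int s mod int p \<in> Y"
      using S[of s] p_gt_1 unfolding Y_def by auto
  next
    fix x assume x: "x \<in> Y"
    then obtain j where j: "[int a ^ j = x] (mod int p)"
      using primroot_power_surj[OF prime_p a] chi_eq_0_iff by (auto simp: Y_def)
    \<comment> \<open>The point of the graph above \<open>x\<close>.\<close>
    let ?s = "a ^ j mod (5 * p)"
    have "[?s = a ^ j] (mod 5)" "[?s = a ^ j] (mod p)"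
      by (simp_all add: cong_def mod_mod_cancel)
    then have sx: "of_nat ?s = (of_nat (a ^ j) :: 'f)" "[int ?s = int (a ^ j)] (mod int p)"
      using of_nat_eq_iff_mod_5[OF char] cong_int_iff by blast+
    then have sx': "[int ?s = x] (mod int p)" using j by (metis cong_trans of_nat_power)
    have "chi (int ?s) = chi x" "chi (int ?s + 1) = chi (x + 1)"
      using chi_cong[OF sx'] chi_cong[OF cong_add[OF sx' cong_refl]] by simp_all
    moreover have "of_nat ?s = chi x"
      using sx(1) chi_a chi_cong[OF j] by metis
    moreover have "?s < 5 * p" using p_gt_1 by simp
    ultimately have "?s \<in> S" "chi (int ?s + 1) \<noteq> 0" "chi (int ?s + 1) = chi (int ?s) + 1"
      using x S[of ?s] unfolding Y_def by (auto simp del: of_nat_mod)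
    then have "?s \<in> R"
      using succ unfolding R_def by blast
    moreover have "x = int ?s mod int p"
      using sx' x by (simp add: cong_def Y_def del: of_nat_mod)
    ultimately show "\<exists>s\<in>R. x = int s mod int p" by blast
  qed
  then have "card R = card Y" by (rule bij_betw_same_card)
  then show ?thesis
    using card_R by (simp only: S_def Y_def)
qed

text \<open>The generator glues \<open>g\<close> modulo \<open>p\<close> with \<open>c\<close>
  modulo 5; then \<open>chi (int a ^ j)\<close> is \<open>a ^ j\<close> in the field, as the graph
  description demands.\<close>

lemma ex_generator_from_character:
  fixes p g c :: nat and chi :: "int \<Rightarrow> 'f::field"
  assumes "quartic_character p chi" and char: "CHAR('f) = 5"
    and p8: "p mod 8 = 5" and p5: "p mod 5 = 1" and g: "ord p g = p - 1" and c: "c \<in> {2, 3}"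
    and chi_g: "\<And>j. chi (int g ^ j) = of_nat c ^ j"
    and jac: "quartic_character.jac p chi 1 2 = - 2"
  shows "\<exists>a :: nat. a < 5 * p \<and> coprime a (5 * p) \<and> ord p a = p - 1 \<and>
       [int a ^ ((p - 1) div 2) = -1] (mod int (5 * p)) \<and>
       [int (card (S_set (5 * p) p a \<inter> shift1 (5 * p) (S_set (5 * p) p a))) = -2] (mod 5)"
proof -
  interpret quartic_character p chi by fact
  have pn5: "p \<noteq> 5" using p5 by auto
  have cop: "coprime p 5"
    using pn5 prime_p primes_coprime[of p 5] by simp
  obtain a where a: "a < p * 5" "[a = g] (mod p)" "[a = c] (mod 5)"
    using binary_chinese_remainder_unique_nat[OF cop, of g c] p_gt_1 by auto
  have ord_a: "ord p a = p - 1"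
    using ord_cong[OF a(2)] g by simp
  have cop_a: "coprime a (5 * p)"
  proof -
    have "coprime p a" using ord_a p_gt_1 by (metis ord_eq_0 zero_less_diff less_numeral_extra(3))
    moreover have "coprime c 5" using c primes_coprime[of 2 "5::nat"] primes_coprime[of 3 "5::nat"] by auto
    then have "coprime a 5" using a(3) cong_imp_coprime cong_sym by blast
    ultimately show ?thesis by (simp add: coprime_commute)
  qed
  have half: "[int a ^ ((p - 1) div 2) = -1] (mod int (5 * p))"
  proof -
    have "[int a ^ ((p - 1) div 2) = -1] (mod int p)"
      by (rule primroot_half_power) (use prime_p p8 ord_a in presburger)+
    moreover have "[int a ^ ((p - 1) div 2) = -1] (mod 5)"
    proof -
      have "[int a = int c] (mod 5)"
        using a(3) by (metis cong_int_iff of_nat_numeral)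
      then have ac: "[int a ^ k = int c ^ k] (mod 5)" for k
        by (rule cong_pow)
      \<comment> \<open>Both 2 and 3 square to -1 modulo 5, and \<open>(p - 1) div 2\<close> is 2
        modulo 4.\<close>
      have "[int c ^ 4 = 1] (mod 5)" "[int c ^ 2 = -1] (mod 5)"
        using c by (auto simp: cong_def)
      then have "[(int c ^ 4) ^ (p div 8) * int c ^ 2 = 1 ^ (p div 8) * -1] (mod 5)"
        by (intro cong_mult cong_pow)
      moreover have "(p - 1) div 2 = 4 * (p div 8) + 2" using p8 by presburger
      ultimately have "[int c ^ ((p - 1) div 2) = -1] (mod 5)"
        by (simp only: power_add power_mult power_one mult_1)
      then show ?thesis using ac cong_trans by blast
    qed
    moreover have "coprime 5 (int p)"
      using cop by (metis coprime_commute coprime_int_iff of_nat_numeral)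
    ultimately show ?thesis
      by (simp add: coprime_cong_mult)
  qed
  have chi_a: "chi (int a ^ j) = of_nat (a ^ j)" for j
  proof -
    have "[int a ^ j = int g ^ j] (mod int p)"
      using a(2) by (intro cong_pow) (simp add: cong_int_iff)
    moreover have "of_nat a = (of_nat c :: 'f)"
      using a(3) of_nat_eq_iff_mod_5[OF char] by blast
    ultimately show ?thesis using chi_g chi_cong by (metis of_nat_power)
  qed
  define N where "N = card (S_set (5 * p) p a \<inter> shift1 (5 * p) (S_set (5 * p) p a))"
  \<comment> \<open>The count is \<open>1 - (-2) = 3\<close> in the field.\<close>
  have "of_nat N = (of_nat 3 :: 'f)"
    unfolding N_def card_S_set_Int_shift[OF char pn5 ord_a chi_a] card_successor_pairs[OF char p5]
    by (simp add: jac[simplified])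
  then have "N mod 5 = 3"
    using of_nat_eq_iff_mod_5[OF char, of N 3] by (simp add: cong_def)
  then have "int N mod 5 = 3" by presburger
  then have "[int N = -2] (mod 5)" by (simp add: cong_def)
  then show ?thesis
    using a(1) cop_a ord_a half unfolding N_def by (intro exI[of _ a]) (simp add: mult.commute)
qed

section \<open>Primes for which -5 is a fourth power\<close>

text \<open>The residue of \<open>z\<close> has exact order \<open>k\<close>. The uses are
  \<open>k = 5\<close> and \<open>k = 4\<close>.\<close>

lemma dvd_prime_minus_1_of_order:
  fixes p k :: nat and z :: int
  assumes p: "prime p" and k0: "k > 0" and "[z ^ k = 1] (mod int p)"
    and "\<And>d. d dvd k \<Longrightarrow> d \<noteq> k \<Longrightarrow> \<not> [z ^ d = 1] (mod int p)"
  shows "k dvd p - 1"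
proof -
  define m where "m = nat (z mod int p)"
  have p1: "p > 1" using p prime_gt_1_nat by blast
  have zm: "[int m = z] (mod int p)"
    using p1 by (simp add: m_def cong_def)
  have eq: "[m ^ d = 1] (mod p) \<longleftrightarrow> [z ^ d = 1] (mod int p)" for d
  proof -
    have "[int m ^ d = z ^ d] (mod int p)" using zm by (rule cong_pow)
    then show ?thesis
      by (metis cong_int_iff cong_sym cong_trans of_nat_1 of_nat_power)
  qed
  have "ord p m dvd k" using assms(3) eq ord_divides by blast
  moreover have "[z ^ ord p m = 1] (mod int p)" using eq ord by blast
  ultimately have k: "ord p m = k" using assms(4) by blast
  show ?thesis
  proof (cases "coprime p m")
    case True
    then show ?thesis using order_divides_totient[of p m] k totient_prime[OF p] by simp
  next
    case False
    then show ?thesis using k k0 by simp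
  qed
qed

text \<open>
  The quartic in \<open>T\<close> is the norm of \<open>1 + T * \<eta> ^ 4\<close>, which factors through the golden field as
  \<open>x ^ 2 - x * y - y ^ 2\<close>; 451 is the resultant of \<open>x\<close> and \<open>y\<close>. In the proof \<open>w\<close> and \<open>z\<close> are the residues
  of \<open>\<zeta> + \<zeta>\<^sup>-\<^sup>1\<close> and \<open>\<zeta>\<close>.
\<close>
lemma prime_divisor_fourth_power:
  fixes p :: nat and n T :: int
  assumes p: "prime p" and T: "T = 5 * n ^ 4" and n451: "\<not> int p dvd 451"
    and N: "int p dvd T ^ 4 - 11 * T ^ 3 + 46 * T ^ 2 + 4 * T + 1"
  shows "p mod 5 = 1 \<and> (odd p \<longrightarrow> p mod 4 = 1) \<and>
    (\<exists>u v. \<not> int p dvd u \<and> \<not> int p dvd v \<and> [- 5 * u ^ 4 = v ^ 4] (mod int p))"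
proof -
  define P where "P = int p"
  have P: "prime P" using p by (simp add: P_def)
  have P1: "P > 1" using P prime_gt_1_int by blast
  have power_dvd: "P dvd a" if "P dvd a ^ k" for a k
    using that P prime_dvd_power by blast
  have NP: "P dvd T ^ 4 - 11 * T ^ 3 + 46 * T ^ 2 + 4 * T + 1"
    using N by (simp add: P_def)
  have P5: "\<not> P dvd 5"
  proof
    assume "P dvd 5"
    then have "P dvd T * (T ^ 3 - 11 * T ^ 2 + 46 * T + 4)" by (simp add: T)
    then have "P dvd (T ^ 4 - 11 * T ^ 3 + 46 * T ^ 2 + 4 * T + 1) - T * (T ^ 3 - 11 * T ^ 2 + 46 * T + 4)"
      using NP by (rule dvd_diff[rotated])
    then have "P dvd 1" by (simp add: eval_nat_numeral algebra_simps)
    then show False using P1 by simp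
  qed
  \<comment> \<open>With \<open>e = (1 + w) ^ 4\<close>, the factor
    \<open>T ^ 2 * e ^ 2 + w * e * T + 1\<close> of the norm over the golden field is
    \<open>x + w * y\<close> times the unit \<open>e ^ 2\<close>, modulo
    \<open>w ^ 2 + w - 1\<close>.\<close>
  define x where "x = T ^ 2 - 3 * T + 13"
  define y where "y = 5 * T - 21"
  have xy: "P dvd x ^ 2 - x * y - y ^ 2"
    using NP by (simp add: x_def y_def eval_nat_numeral algebra_simps)
  have "\<not> P dvd y"
  proof
    assume y: "P dvd y"
    then have "P dvd (x ^ 2 - x * y - y ^ 2) + (x + y) * y"
      using xy by (intro dvd_add dvd_mult)
    then have "P dvd x ^ 2" by (simp add: power2_eq_square algebra_simps)
    then have "P dvd x" by (rule power_dvd)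
    then have "P dvd 25 * x - (5 * T + 6) * y" using dvd_mult[OF y] by (rule dvd_diff[OF dvd_mult])
    also have "25 * x - (5 * T + 6) * y = 451"
      by (simp add: x_def y_def power2_eq_square algebra_simps)
    finally show False using n451 by (simp add: P_def)
  qed
  then have "coprime y P"
    using P by (simp add: coprime_commute prime_imp_coprime)
  then obtain y' where y': "[y * y' = 1] (mod P)"
    using cong_solve_coprime_int by blast
  \<comment> \<open>Chosen to annihilate the factor \<open>x + w * y\<close> modulo
    \<open>P\<close>.\<close>
  define w where "w = - x * y'"
  have X: "P dvd x + w * y"
  proof -
    have "P dvd (y * y' - 1) * (- x)" using y' by (intro dvd_mult2) (simp add: cong_iff_dvd_diff)
    then show ?thesis by (simp add: w_def algebra_simps)
  qed
  define Q where "Q = w ^ 2 + w - 1"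
  have Q: "P dvd Q"
  proof -
    have "y ^ 2 * Q = (x ^ 2 - x * y - y ^ 2) - (x + w * y) * (x - w * y - y)"
      by (simp add: Q_def power2_eq_square algebra_simps)
    then have "P dvd y ^ 2 * Q" using dvd_diff[OF xy dvd_mult2[OF X]] by (simp only:)
    moreover have "\<not> P dvd y ^ 2" using \<open>\<not> P dvd y\<close> power_dvd by blast
    ultimately show ?thesis using P prime_dvd_mult_iff by blast
  qed
  \<comment> \<open>\<open>e\<close> is \<open>(1 + w) ^ 4\<close> reduced by
    \<open>w ^ 2 = 1 - w\<close>. As \<open>\<eta> = \<zeta> * (1 + w)\<close>, the equation
    \<open>1 + T * \<eta> ^ 4 = 0\<close> solves to \<open>\<zeta> = - T * e\<close>.\<close>
  define e where "e = 5 + 3 * w"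
  define z where "z = - T * e"
  define R where "R = z ^ 2 - w * z + 1"
  have R: "P dvd R"
  proof -
    have "R = e ^ 2 * ((x + w * y) + Q * (9 - 3 * T)) + Q * (9 * e * w * T + 18 - 81 * Q)"
      unfolding R_def z_def e_def Q_def x_def y_def by (simp add: eval_nat_numeral algebra_simps)
    then show ?thesis
      using dvd_add[OF dvd_mult[OF dvd_add[OF X dvd_mult2[OF Q]]] dvd_mult2[OF Q]] by (simp only:)
  qed
  define F where "F = z ^ 4 + z ^ 3 + z ^ 2 + z + 1"
  have F: "P dvd F"
  proof -
    \<comment> \<open>Modulo \<open>Q\<close>, the fifth cyclotomic polynomial is \<open>R\<close>
      times its conjugate under \<open>w\<close> to \<open>-1 - w\<close>.\<close>
    have "F = R * (z ^ 2 + (1 + w) * z + 1) + Q * z ^ 2"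
      unfolding F_def R_def Q_def by (simp add: eval_nat_numeral algebra_simps)
    then show ?thesis using dvd_add[OF dvd_mult2[OF R] dvd_mult2[OF Q]] by (simp only:)
  qed
  have z5: "[z ^ 5 = 1] (mod P)"
  proof -
    have "z ^ 5 - 1 = F * (z - 1)" unfolding F_def by (simp add: eval_nat_numeral algebra_simps)
    then show ?thesis using F by (simp add: cong_iff_dvd_diff)
  qed
  have z1: "\<not> P dvd z - 1"
  proof
    assume "P dvd z - 1"
    then have "P dvd F - (z - 1) * (z ^ 3 + 2 * z ^ 2 + 3 * z + 4)"
      by (rule dvd_diff[OF F dvd_mult2])
    also have "F - (z - 1) * (z ^ 3 + 2 * z ^ 2 + 3 * z + 4) = 5" unfolding F_def by (simp add: eval_nat_numeral algebra_simps)
    finally show False using P5 by simp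
  qed
  have zn: "\<not> P dvd z"
  proof
    assume "P dvd z"
    then have "P dvd z * z ^ 4 - (z ^ 5 - 1)"
      using z5 unfolding cong_iff_dvd_diff by (rule dvd_diff[OF dvd_mult2])
    then have "P dvd 1" by (simp add: eval_nat_numeral)
    then show False using P1 by simp
  qed
  have "5 dvd p - 1"
  proof (rule dvd_prime_minus_1_of_order[OF p])
    show "[z ^ 5 = 1] (mod int p)" using z5 by (simp add: P_def)
    fix d :: nat assume "d dvd 5" "d \<noteq> 5"
    moreover have "prime (5::nat)" by simp
    ultimately have "d = 1" by (metis prime_nat_iff)
    then show "\<not> [z ^ d = 1] (mod int p)" using z1 by (simp add: cong_iff_dvd_diff P_def)
  qed simp
  then have mod5: "p mod 5 = 1"
    using p prime_gt_1_nat[of p] by presburger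
  \<comment> \<open>Modulo \<open>P\<close>, \<open>(1 + z) ^ 4 = e * z ^ 2\<close>, hence
    \<open>- 5 * u ^ 4 = - T * e * z ^ 2 = z ^ 3 = z ^ 8 = v ^ 4\<close>.\<close>
  define u where "u = n * (1 + z)"
  define v where "v = z ^ 2"
  have uv: "P dvd - 5 * u ^ 4 - v ^ 4"
  proof -
    have z3: "- T * (e * z ^ 2) = z ^ 3" by (simp add: z_def power2_eq_square power3_eq_cube)
    have "(1 + z) ^ 4 = e * z ^ 2 + R * (R + 2 * (2 + w) * z) + Q * z ^ 2"
      unfolding R_def e_def Q_def by (simp add: eval_nat_numeral algebra_simps)
    then have "- 5 * u ^ 4 - v ^ 4 = - T * (e * z ^ 2 + R * (R + 2 * (2 + w) * z) + Q * z ^ 2) - v ^ 4"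
      by (simp add: u_def T power_mult_distrib)
    also have "\<dots> = - T * (e * z ^ 2) - v ^ 4 + R * (- T * (R + 2 * (2 + w) * z)) + Q * (- T * z ^ 2)"
      by (simp add: eval_nat_numeral algebra_simps)
    also have "\<dots> = (z ^ 5 - 1) * (- (z ^ 3)) + R * (- T * (R + 2 * (2 + w) * z)) + Q * (- T * z ^ 2)"
      unfolding z3 v_def by (simp add: eval_nat_numeral algebra_simps)
    finally show ?thesis
      using dvd_add[OF dvd_add[OF dvd_mult2[OF z5[unfolded cong_iff_dvd_diff]] dvd_mult2[OF R]] dvd_mult2[OF Q]]
      by (simp only:)
  qed
  have vn: "\<not> P dvd v" using zn power_dvd unfolding v_def by blast
  have un: "\<not> P dvd u"
  proof
    assume "P dvd u"
    then have "P dvd u * (- 5 * u ^ 3) - (- 5 * u ^ 4 - v ^ 4)"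
      by (rule dvd_diff[OF dvd_mult2 uv])
    then have "P dvd v ^ 4" by (simp add: eval_nat_numeral)
    then show False using vn power_dvd by blast
  qed
  have mod4: "p mod 4 = 1" if odd: "odd p"
  proof -
    have "coprime (v ^ 2) P"
      using P vn power_dvd by (metis coprime_commute prime_imp_coprime)
    then obtain s where s: "[v ^ 2 * s = 1] (mod P)"
      using cong_solve_coprime_int by blast
    \<comment> \<open>\<open>1 + 2 * w\<close> is a square root of 5 modulo \<open>P\<close>, so
      \<open>t ^ 2 = 5 * u ^ 4 / v ^ 4 = -1\<close>.\<close>
    define t where "t = (1 + 2 * w) * u ^ 2 * s"
    have t2: "[t ^ 2 = -1] (mod P)"
    proof -
      have "t ^ 2 + 1 = s ^ 2 * (Q * (4 * u ^ 4) - (- 5 * u ^ 4 - v ^ 4)) - (v ^ 2 * s - 1) * (v ^ 2 * s + 1)"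
        unfolding t_def Q_def by (simp add: eval_nat_numeral algebra_simps)
      moreover have "P dvd v ^ 2 * s - 1" using s by (simp add: cong_iff_dvd_diff)
      ultimately have "P dvd t ^ 2 + 1"
        using dvd_diff[OF dvd_mult[OF dvd_diff[OF dvd_mult2[OF Q] uv]] dvd_mult2] by (simp only:)
      then show ?thesis by (simp add: cong_iff_dvd_diff)
    qed
    have P2: "\<not> P dvd 2"
    proof
      assume "P dvd 2"
      then have "P = 2" using P1 zdvd_imp_le[of P 2] by auto
      then show False using odd by (simp add: P_def)
    qed
    have t2n: "\<not> [t ^ 2 = 1] (mod P)"
    proof
      assume "[t ^ 2 = 1] (mod P)"
      then have "[1 = -1] (mod P)" using t2 cong_trans cong_sym by blast
      then show False using P2 by (simp add: cong_iff_dvd_diff)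
    qed
    have "4 dvd p - 1"
    proof (rule dvd_prime_minus_1_of_order[OF p])
      have "[(t ^ 2) ^ 2 = (-1) ^ 2] (mod P)" using t2 by (rule cong_pow)
      then show "[t ^ 4 = 1] (mod int p)" by (simp add: P_def)
      fix d :: nat assume d: "d dvd 4" "d \<noteq> 4"
      then have "d \<le> 4" by (simp add: dvd_imp_le)
      then have "d \<in> {0,1,2,3,4}" by auto
      then have "d dvd 2" using d by auto
      then obtain k where k: "2 = d * k" by blast
      show "\<not> [t ^ d = 1] (mod int p)"
      proof
        assume "[t ^ d = 1] (mod int p)"
        then have "[(t ^ d) ^ k = 1 ^ k] (mod P)" unfolding P_def by (rule cong_pow)
        then show False using t2n by (simp add: k power_mult)
      qed
    qed simp
    then show ?thesis using p prime_gt_1_nat[of p] by presburger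
  qed
  show ?thesis
    using mod5 mod4 un vn uv unfolding P_def cong_iff_dvd_diff by blast
qed

section \<open>Euclid's argument\<close>

lemma mod_8_eq_1_of_prime_divisors:
  fixes n :: nat
  assumes "n > 0" "\<And>q. prime q \<Longrightarrow> q dvd n \<Longrightarrow> q mod 8 = 1"
  shows "n mod 8 = 1"
  using assms
proof (induction n rule: less_induct)
  case (less n)
  show ?case
  proof (cases "n = 1")
    case False
    then obtain q where q: "prime q" "q dvd n" using prime_factor_nat by blast
    then obtain m where m: "n = q * m" by blast
    have "m < n" "m > 0" using m less.prems(1) prime_gt_1_nat[OF q(1)] by auto
    then have "m mod 8 = 1" using less.IH[of m] less.prems(2) m by auto
    moreover have "q mod 8 = 1" using less.prems(2) q by blast
    ultimately show ?thesis using mod_mult_eq[of q 8 m] by (simp add: m)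
  qed simp
qed

lemma ex_large_prime_fourth_power:
  "\<exists>p > B. prime p \<and> p mod 8 = 5 \<and> p mod 5 = 1 \<and>
    (\<exists>u v. \<not> int p dvd u \<and> \<not> int p dvd v \<and> [- 5 * u ^ 4 = v ^ 4] (mod int p))"
proof -
  define D where "D = {q::nat. prime q \<and> odd q \<and> q \<le> B}"
  \<comment> \<open>All odd primes up to \<open>B\<close> and the primes dividing 451 divide
    \<open>n\<close>, while \<open>N\<close> is 1 modulo \<open>n\<close>; so no prime divisor of
    \<open>N\<close> is among them. Oddness of \<open>n\<close> fixes \<open>N\<close> modulo
    8.\<close>
  define n where "n = 451 * int (\<Prod>D)"
  define T where "T = 5 * n ^ 4"
  define N where "N = T ^ 4 - 11 * T ^ 3 + 46 * T ^ 2 + 4 * T + 1"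
  have fin: "finite D" by (rule finite_subset[of _ "{..B}"]) (auto simp: D_def)
  have "odd (\<Prod>D)"
    using fin by (subst even_prod_iff) (auto simp: D_def)
  then have "odd n" by (simp add: n_def del: of_nat_prod)
  have T8: "T mod 8 = 5"
  proof -
    have "n mod 8 \<in> {1, 3, 5, 7}" using \<open>odd n\<close> by auto presburger
    then have "n ^ 4 mod 8 = 1" using power_mod[of n 8 4] by auto
    then show ?thesis unfolding T_def by (simp add: mod_mult_right_eq[of 5 "n ^ 4" 8, symmetric])
  qed
  have N8: "N mod 8 = 5"
  proof -
    have "[T = 5] (mod 8)" using T8 by (simp add: cong_def)
    then have "[N = 5 ^ 4 - 11 * 5 ^ 3 + 46 * 5 ^ 2 + 4 * 5 + 1] (mod 8)"
      unfolding N_def by (intro cong_add cong_diff cong_mult cong_pow cong_refl)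
    then show ?thesis by (simp add: cong_def)
  qed
  have "T \<ge> 0" by (simp add: T_def)
  have "N > 0"
  proof -
    \<comment> \<open>Completing the square gives positivity.\<close>
    have "4 * N = T ^ 2 * ((2 * T - 11) ^ 2 + 63) + 16 * T + 4"
      unfolding N_def by (simp add: eval_nat_numeral algebra_simps)
    moreover have "T ^ 2 * ((2 * T - 11) ^ 2 + 63) \<ge> 0" by (intro mult_nonneg_nonneg) auto
    ultimately show ?thesis using \<open>T \<ge> 0\<close> by linarith
  qed
  have ndvd: "\<not> int q dvd n" if "prime q" "int q dvd N" for q
  proof
    assume "int q dvd n"
    then have "int q dvd T" unfolding T_def by (intro dvd_mult) (simp add: dvd_trans[OF _ dvd_power])
    then have "int q dvd N - T * (T ^ 3 - 11 * T ^ 2 + 46 * T + 4)"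
      by (rule dvd_diff[OF that(2) dvd_mult2])
    also have "N - T * (T ^ 3 - 11 * T ^ 2 + 46 * T + 4) = 1" unfolding N_def by (simp add: eval_nat_numeral algebra_simps)
    finally show False using that(1) not_prime_1 by auto
  qed
  have main: "odd q \<and> q > B \<and> q mod 5 = 1 \<and> q mod 4 = 1 \<and>
      (\<exists>u v. \<not> int q dvd u \<and> \<not> int q dvd v \<and> [- 5 * u ^ 4 = v ^ 4] (mod int q))"
    if q: "prime q" "int q dvd N" for q
  proof -
    have "odd q"
    proof
      assume "even q"
      then have "2 dvd int q" by simp
      then have "2 dvd N" using q(2) dvd_trans by blast
      then show False using N8 by presburger
    qed
    have "q > B"
    proof (rule ccontr)
      assume "\<not> q > B"
      then have "q \<in> D" using q \<open>odd q\<close> by (simp add: D_def)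
      then have "q dvd \<Prod>D" using fin by (rule dvd_prodI[of D q "\<lambda>x. x", rotated])
      then have "int q dvd n" unfolding n_def by (intro dvd_mult) (simp only: int_dvd_int_iff)
      then show False using ndvd q by blast
    qed
    have "\<not> int q dvd 451"
    proof
      assume "int q dvd 451"
      then have "int q dvd n" unfolding n_def by (rule dvd_mult2)
      then show False using ndvd q by blast
    qed
    then show ?thesis
      using prime_divisor_fourth_power[OF q(1) T_def] q(2) \<open>odd q\<close> \<open>q > B\<close> unfolding N_def by blast
  qed
  have "int (nat N mod 8) = 5" using N8 \<open>N > 0\<close> by (simp add: zmod_int)
  then have "nat N mod 8 \<noteq> 1" by linarith
  then obtain q where q: "prime q" "q dvd nat N" "q mod 8 \<noteq> 1"
    using mod_8_eq_1_of_prime_divisors[of "nat N"] \<open>N > 0\<close> by auto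
  then have "int q dvd N" using \<open>N > 0\<close> int_dvd_int_iff[of q "nat N"] by simp
  note mq = main[OF q(1) this]
  moreover have "q mod 8 = 5"
  proof -
    have "q mod 4 = 1" using mq by blast
    then show ?thesis using q(3) by presburger
  qed
  ultimately show ?thesis using q(1) by blast
qed

section \<open>Choice of the generator\<close>

text \<open>The type \<open>finite_5\<close> only serves as an index type with five elements for the prime field.\<close>
lemma CARD_finite_5: "CARD(Enum.finite_5) = 5"
  by (simp add: UNIV_finite_5)

instance Enum.finite_5 :: prime_card
  by standard (simp add: CARD_finite_5)

lemma ex_generator:
  fixes p :: nat and u v :: int
  assumes p: "prime p" and p8: "p mod 8 = 5" and p5: "p mod 5 = 1"
    and uv: "\<not> int p dvd u" "\<not> int p dvd v" "[- 5 * u ^ 4 = v ^ 4] (mod int p)"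
  shows "\<exists>a :: nat. a < 5 * p \<and> coprime a (5 * p) \<and> ord p a = p - 1 \<and>
       [int a ^ ((p - 1) div 2) = -1] (mod int (5 * p)) \<and>
       [int (card (S_set (5 * p) p a \<inter> shift1 (5 * p) (S_set (5 * p) p a))) = -2] (mod 5)"
proof -
  have p1: "p > 1" using p prime_gt_1_nat by blast
  \<comment> \<open>The algebraic closure of the field with five elements supplies the root of unity
    for the Gauss sums.\<close>
  have char: "CHAR(Enum.finite_5 mod_ring alg_closure) = 5"
    by (simp add: CARD_finite_5)
  obtain g where g: "ord p g = p - 1"
    using residue_prime_has_primroot[OF p] by blast
  obtain chi :: "int \<Rightarrow> Enum.finite_5 mod_ring alg_closure"
    where chi: "quartic_character p chi" and chi_g: "chi (int g ^ j) = 2 ^ j" for j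
    using ex_quartic_character[OF p g p8 char] by blast
  interpret quartic_character p chi by fact
  have five: "(5 :: Enum.finite_5 mod_ring alg_closure) = 0"
    using of_nat_CHAR[where 'a = "Enum.finite_5 mod_ring alg_closure"] char by simp
  have "of_nat p \<noteq> (0 :: Enum.finite_5 mod_ring alg_closure)"
    using of_nat_eq_0_iff_char_dvd[of p, where 'a = "Enum.finite_5 mod_ring alg_closure"] p5
    unfolding char by auto
  then obtain zeta :: "Enum.finite_5 mod_ring alg_closure" where "zeta ^ p = 1" "zeta \<noteq> 1"
    using ex_nontrivial_root_of_unity p1 by blast
  then interpret quartic_gauss_sum p chi zeta
    by unfold_locales
  \<comment> \<open>Fourth powers prime to \<open>p\<close> have character value 1, so
    \<open>chi (- 5) = 1\<close>.\<close>
  have "chi (- 5 * u ^ 4) = chi (v ^ 4)" using uv(3) by (rule chi_cong)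
  moreover have "chi u ^ 4 = 1" "chi v ^ 4 = 1"
    using uv by (simp_all add: chi_power_4 chi_eq_0_iff)
  ultimately have "chi (- 5) = 1" by (simp only: chi_mult chi_power mult_1_right)
  then have chi5: "chi 5 = -1" using chi_minus[of 5] by (metis minus_minus)
  define J where "J = jac 1 2"
  have "J ^ 2 = -1" and J3: "J * jac 3 2 = 1"
    using jac_1_2_identities[OF char p5] by (simp_all only: J_def chi5) simp_all
  then have "(J - 2) * (J + 2) = - 5"
    by (simp add: power2_eq_square algebra_simps)
  then have "J = 2 \<or> J = -2"
    by (simp add: five eq_neg_iff_add_eq_0)
  then show ?thesis
  proof
    assume "J = -2"
    then show ?thesis
      using ex_generator_from_character[OF chi char p8 p5 g, of 2] chi_g by (simp add: J_def)
  next
    assume J: "J = 2"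
    \<comment> \<open>The inverse of 2 in characteristic 5 is 3, that is -2.\<close>
    have "jac 3 2 = -2 * (J * jac 3 2) + 5 * jac 3 2"
      by (simp add: J algebra_simps)
    then have "jac 3 2 = -2" by (simp only: J3 five) simp
    moreover have "quartic_character.jac p (\<lambda>x. chi x ^ 3) 1 2 = jac 3 2"
    proof -
      have "chi x ^ 6 = chi x ^ 2" for x
        using chi_power_5[of x] by (simp add: eval_nat_numeral)
      then show ?thesis
        unfolding quartic_character.jac_def[OF quartic_character_cube] jac_def
        by (simp flip: power_mult)
    qed
    moreover have "chi (int g ^ j) ^ 3 = of_nat 3 ^ j" for j
    proof -
      \<comment> \<open>The cube sends \<open>g\<close> to \<open>2 ^ 3 = 3\<close>, so the residue
        modulo 5 becomes 3.\<close>
      have "(8 :: Enum.finite_5 mod_ring alg_closure) = 3 + 5" by simp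
      also have "\<dots> = 3" by (simp only: five add_0_right)
      finally have "(2 :: Enum.finite_5 mod_ring alg_closure) ^ 3 = 3" by simp
      then show ?thesis
        unfolding chi_g by (simp only: power_mult[symmetric] mult.commute[of j 3]) (simp only: power_mult of_nat_numeral)
    qed
    ultimately show ?thesis
      using ex_generator_from_character[OF quartic_character_cube char p8 p5 g, of 3] by simp
  qed
qed

theorem mainTheorem13:
  shows "infinite {p :: nat. prime p \<and>
    (\<exists>a :: nat. a < 5 * p \<and> coprime a (5 * p) \<and>
       ord p a = p - 1 \<and>
       [int a ^ ((p - 1) div 2) = -1] (mod int (5 * p)) \<and>
       [int (card (S_set (5 * p) p a \<inter> shift1 (5 * p) (S_set (5 * p) p a))) = -2] (mod 5))}"
  unfolding infinite_nat_iff_unbounded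
proof
  fix B
  show "\<exists>n>B. n \<in> {p :: nat. prime p \<and>
    (\<exists>a :: nat. a < 5 * p \<and> coprime a (5 * p) \<and>
       ord p a = p - 1 \<and>
       [int a ^ ((p - 1) div 2) = -1] (mod int (5 * p)) \<and>
       [int (card (S_set (5 * p) p a \<inter> shift1 (5 * p) (S_set (5 * p) p a))) = -2] (mod 5))}"
    using ex_large_prime_fourth_power[of B] ex_generator unfolding mem_Collect_eq by blast
qed

end
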